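(* Let $K$ be a compact metric space and let $f$ be a Baire-1 function on $K$ (not assumed bounded). There exists a sequence $(f_n)\subseteq C(K)$ such that $(f_n)$ converges pointwise to $f$ and $\gamma((f_n))=\beta(f)$.
   Context: A function on a compact metric space is Baire-1 if it is the pointwise limit of a sequence of real-valued continuous functions. $C(K)$ is the set of continuous real-valued functions on $K$. Oscillation index. Let $H$ be a compact metric space, $f$ a real-valued function whose domain contains $H$, and $\varepsilon>0$. Put $H^0(f,\varepsilon)=H$. For a countable ordinal $\alpha$, $H^{\alpha+1}(f,\varepsilon)$ is the set of all $x\in H^\alpha(f,\varepsilon)$ such that for every open set $U$ containing $x$ there are $x_1,x_2\in U\cap H^\alpha(f,\varepsilon)$ with $|f(x_1)-f(x_2)|\ge\varepsilon$. For a countable limit ordinal $\alpha$, $H^\alpha(f,\varepsilon)=\bigcap_{\alpha'<\alpha}H^{\alpha'}(f,\varepsilon)$. Let $\beta_H(f,\varepsilon)$ be the least countable $\alpha$ with $H^\alpha(f,\varepsilon)=\emptyset$ if such $\alpha$ exists, and $\omega_1$ otherwise; $\beta_H(f)=\sup_{\varepsilon>0}\beta_H(f,\varepsilon)$. Write $\beta$ for $\beta_K$. Convergence index. For a sequence $(f_n)$ of real-valued functions whose domains contain $H$ and $\varepsilon>0$, put $H^0((f_n),\varepsilon)=H$; $H^{\alpha+1}((f_n),\varepsilon)$ is the set of all $x\in H^\alpha((f_n),\varepsilon)$ such that for every open set $U$ containing $x$ and every $m\in\mathbb{N}$ there are integers $n_1>n_2>m$ and $x'\in U\cap H^\alpha((f_n),\varepsilon)$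 with $|f_{n_1}(x')-f_{n_2}(x')|\ge\varepsilon$; intersections are taken at countable limit ordinals. Let $\gamma_H((f_n),\varepsilon)$ be the least countable $\alpha$ with $H^\alpha((f_n),\varepsilon)=\emptyset$ if it exists, and $\omega_1$ otherwise; $\gamma_H((f_n))=\sup_{\varepsilon>0}\gamma_H((f_n),\varepsilon)$. Write $\gamma$ for $\gamma_K$. *)

theory Defs
  imports "HOL-Analysis.Analysis"
begin

section \<open>The ordinals up to and including the first uncountable ordinal\<close>

text \<open>
  \<open>cardSuc natLeq\<close> is a well-order of type \<open>\<omega>\<^sub>1\<close>. Its elements stand for the countable
  ordinals; \<open>None\<close> is adjoined above them and stands for \<open>\<omega>\<^sub>1\<close> itself.
\<close>

abbreviation w1_rel :: "nat set rel" where
  "w1_rel \<equiv> cardSuc natLeq"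

typedef ord_w1 = "insert None (Some ` Field w1_rel)"
  by blast

lemma w1_rel_Well_order: "Well_order w1_rel"
  by (rule cardSuc_Well_order[OF natLeq_Card_order])

lemma Rep_ord_w1_Some: "Rep_ord_w1 a = Some x \<Longrightarrow> x \<in> Field w1_rel"
  using Rep_ord_w1[of a] by auto

instantiation ord_w1 :: linorder
begin

definition less_eq_ord_w1 :: "ord_w1 \<Rightarrow> ord_w1 \<Rightarrow> bool" where
  "(a :: ord_w1) \<le> b \<longleftrightarrow> (case Rep_ord_w1 b of None \<Rightarrow> True
     | Some y \<Rightarrow> (case Rep_ord_w1 a of None \<Rightarrow> False | Some x \<Rightarrow> (x, y) \<in> w1_rel))"

definition less_ord_w1 :: "ord_w1 \<Rightarrow> ord_w1 \<Rightarrow> bool" where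
  "(a :: ord_w1) < b \<longleftrightarrow> a \<le> b \<and> a \<noteq> b"

instance
proof
  have wo: "Refl w1_rel" "trans w1_rel" "antisym w1_rel" "Total w1_rel"
    using w1_rel_Well_order
    by (auto simp: well_order_on_def linear_order_on_def partial_order_on_def preorder_on_def)
  fix a b c :: ord_w1
  show refl: "a \<le> a"
    using wo(1) Rep_ord_w1_Some[of a]
    by (auto simp: less_eq_ord_w1_def refl_on_def split: option.splits)
  show "a \<le> b \<Longrightarrow> b \<le> c \<Longrightarrow> a \<le> c"
    using wo(2) by (auto simp: less_eq_ord_w1_def split: option.splits elim: transE)
  show anti: "a \<le> b \<Longrightarrow> b \<le> a \<Longrightarrow> a = b"
    using wo(3)
    by (auto simp: less_eq_ord_w1_def Rep_ord_w1_inject[symmetric] split: option.splits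
        dest: antisymD)
  show "a \<le> b \<or> b \<le> a"
    using wo(1,4) Rep_ord_w1_Some[of a] Rep_ord_w1_Some[of b]
    by (auto simp: less_eq_ord_w1_def total_on_def refl_on_def split: option.splits) metis
  show "a < b \<longleftrightarrow> a \<le> b \<and> \<not> b \<le> a"
    using refl anti by (auto simp: less_ord_w1_def)
qed

end

instance ord_w1 :: wellorder
proof
  fix P :: "ord_w1 \<Rightarrow> bool" and a
  assume step: "\<And>x. (\<And>y. y < x \<Longrightarrow> P y) \<Longrightarrow> P x"
  have wf: "wf (w1_rel - Id)"
    using w1_rel_Well_order by (simp add: well_order_on_def)
  have countable_case: "\<forall>c. Rep_ord_w1 c = Some x \<longrightarrow> P c" for x
  proof (induction x rule: wf_induct_rule[OF wf])
    case (1 x)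
    show ?case
    proof (intro allI impI)
      fix c assume c: "Rep_ord_w1 c = Some x"
      show "P c"
      proof (rule step)
        fix y assume "y < c"
        then obtain z where "Rep_ord_w1 y = Some z" "(z, x) \<in> w1_rel" "z \<noteq> x"
          using c by (auto simp: less_ord_w1_def less_eq_ord_w1_def
              Rep_ord_w1_inject[symmetric] split: option.splits)
        with 1 show "P y" by auto
      qed
    qed
  qed
  show "P a"
  proof (cases "Rep_ord_w1 a")
    case None
    show ?thesis
    proof (rule step)
      fix y assume "y < a"
      then have "Rep_ord_w1 y \<noteq> None"
        using None by (auto simp: less_ord_w1_def Rep_ord_w1_inject[symmetric])
      then show "P y" using countable_case by auto
    qed
  qed (use countable_case in auto)
qed

instantiation ord_w1 :: complete_linorder
begin

definition bot_ord_w1 :: ord_w1 where "bot = (LEAST a :: ord_w1. True)"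
definition top_ord_w1 :: ord_w1 where "top = Abs_ord_w1 None"
definition inf_ord_w1 :: "ord_w1 \<Rightarrow> ord_w1 \<Rightarrow> ord_w1" where "inf = (min :: ord_w1 \<Rightarrow> _)"
definition sup_ord_w1 :: "ord_w1 \<Rightarrow> ord_w1 \<Rightarrow> ord_w1" where "sup = (max :: ord_w1 \<Rightarrow> _)"
definition Inf_ord_w1 :: "ord_w1 set \<Rightarrow> ord_w1" where
  "Inf A = (if A = {} then top else (LEAST a :: ord_w1. a \<in> A))"
definition Sup_ord_w1 :: "ord_w1 set \<Rightarrow> ord_w1" where
  "Sup A = (LEAST b :: ord_w1. \<forall>a\<in>A. a \<le> b)"

instance
proof
  have top: "a \<le> top" for a :: ord_w1
    by (simp add: top_ord_w1_def less_eq_ord_w1_def Abs_ord_w1_inverse)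
  have bot: "bot \<le> a" for a :: ord_w1
    by (simp add: bot_ord_w1_def Least_le)
  fix x z :: ord_w1 and A :: "ord_w1 set"
  show Inf1: "x \<in> A \<Longrightarrow> Inf A \<le> x"
    by (auto simp: Inf_ord_w1_def intro: Least_le)
  show Inf2: "(\<And>x. x \<in> A \<Longrightarrow> z \<le> x) \<Longrightarrow> z \<le> Inf A"
    using top by (auto simp: Inf_ord_w1_def intro: LeastI2_ex)
  have ub: "\<forall>a\<in>A. a \<le> Sup A"
    unfolding Sup_ord_w1_def using LeastI[of "\<lambda>b. \<forall>a\<in>A. a \<le> b" top] top by blast
  then show "x \<in> A \<Longrightarrow> x \<le> Sup A" by blast
  show "(\<And>x. x \<in> A \<Longrightarrow> x \<le> z) \<Longrightarrow> Sup A \<le> z"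
    by (auto simp: Sup_ord_w1_def intro: Least_le)
  show "Inf {} = (top :: ord_w1)" by (simp add: Inf_ord_w1_def)
  show "Sup {} = (bot :: ord_w1)" by (simp add: Sup_ord_w1_def bot_ord_w1_def)
qed (auto simp: inf_ord_w1_def sup_ord_w1_def)

end

abbreviation omega1 :: ord_w1 ("\<omega>\<^sub>1") where
  "\<omega>\<^sub>1 \<equiv> top"

lemma Rep_omega1: "Rep_ord_w1 \<omega>\<^sub>1 = None"
  by (simp add: top_ord_w1_def Abs_ord_w1_inverse)

lemma Rep_ord_w1_less_omega1:
  assumes "a < \<omega>\<^sub>1" obtains x where "Rep_ord_w1 a = Some x" "x \<in> Field w1_rel"
  using assms Rep_omega1 Rep_ord_w1_Some[of a] Rep_ord_w1_inject[of a "\<omega>\<^sub>1"]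
  by (cases "Rep_ord_w1 a") auto

text \<open>
  The next two lemmas characterise \<open>\<omega>\<^sub>1\<close> up to isomorphism: it is the least ordinal with
  uncountably many predecessors.
\<close>

lemma countable_below:
  includes cardinal_syntax
  assumes "a < \<omega>\<^sub>1" shows "countable {..<a}"
proof -
  obtain x where x: "Rep_ord_w1 a = Some x" "x \<in> Field w1_rel"
    using assms by (rule Rep_ord_w1_less_omega1)
  have "|underS w1_rel x| <o w1_rel"
    using x(2) by (rule card_of_underS[OF cardSuc_Card_order[OF natLeq_Card_order]])
  then have "|underS w1_rel x| \<le>o natLeq"
    using cardSuc_ordLess_ordLeq[OF natLeq_Card_order card_of_Card_order]
    by (metis card_of_Card_order cardSuc_ordLeq_ordLess natLeq_Card_order)
  then have "|underS w1_rel x| \<le>o |UNIV :: nat set|"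
    using card_of_nat ordIso_symmetric ordLeq_ordIso_trans by blast
  then obtain g :: "nat set \<Rightarrow> nat" where g: "inj_on g (underS w1_rel x)"
    unfolding card_of_ordLeq[symmetric] by auto
  have cU: "countable (underS w1_rel x)"
    using g by (rule countableI')
  have "Rep_ord_w1 ` {..<a} \<subseteq> Some ` underS w1_rel x"
    using x by (auto simp: less_ord_w1_def less_eq_ord_w1_def underS_def
        Rep_ord_w1_inject[symmetric] split: option.splits)
  then have "countable (Rep_ord_w1 ` {..<a})"
    using cU by (meson countable_image countable_subset)
  then show ?thesis
    by (rule countable_image_inj_on) (simp add: inj_on_def Rep_ord_w1_inject)
qed

lemma uncountable_below_omega1:
  includes cardinal_syntax
  shows "uncountable {..<\<omega>\<^sub>1}"
proof
  assume "countable {..<\<omega>\<^sub>1}"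
  then have "countable ((\<lambda>a. the (Rep_ord_w1 a)) ` {..<\<omega>\<^sub>1})"
    by simp
  moreover have "Field w1_rel \<subseteq> (\<lambda>a. the (Rep_ord_w1 a)) ` {..<\<omega>\<^sub>1}"
  proof
    fix x assume x: "x \<in> Field w1_rel"
    then have R: "Rep_ord_w1 (Abs_ord_w1 (Some x)) = Some x"
      by (simp add: Abs_ord_w1_inverse)
    then have "Abs_ord_w1 (Some x) < \<omega>\<^sub>1"
      using Rep_omega1 by (metis option.distinct(1) top.not_eq_extremum)
    with R show "x \<in> (\<lambda>a. the (Rep_ord_w1 a)) ` {..<\<omega>\<^sub>1}"
      by (metis image_eqI lessThan_iff option.sel)
  qed
  ultimately have "countable (Field w1_rel)"
    using countable_subset by blast
  then obtain g :: "nat set \<Rightarrow> nat" where "inj_on g (Field w1_rel)"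
    unfolding countable_def by blast
  then have "|Field w1_rel| \<le>o |UNIV :: nat set|"
    using card_of_ordLeq[of "Field w1_rel" "UNIV :: nat set"] by auto
  then have "|Field w1_rel| \<le>o natLeq"
    using card_of_nat ordLeq_ordIso_trans by blast
  moreover have "natLeq <o |Field w1_rel|"
    using cardSuc_greater[OF natLeq_Card_order]
      card_of_Field_ordIso[OF cardSuc_Card_order[OF natLeq_Card_order]]
    by (meson ordIso_symmetric ordLess_ordIso_trans)
  ultimately show False
    using not_ordLess_ordLeq by blast
qed

text \<open>
  Ordinal successor \<open>\<alpha> + 1\<close>. At \<open>\<omega>\<^sub>1\<close> the successor lies outside the type, and the value is
  unspecified.
\<close>

definition osuc :: "ord_w1 \<Rightarrow> ord_w1" where
  "osuc a = (LEAST b. a < b)"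

lemma osuc_greater: "a < \<omega>\<^sub>1 \<Longrightarrow> a < osuc a"
  unfolding osuc_def by (rule LeastI)

lemma osuc_le: "a < b \<Longrightarrow> osuc a \<le> b"
  unfolding osuc_def by (rule Least_le)

lemma osuc_inj: "a < osuc a \<Longrightarrow> b < osuc b \<Longrightarrow> osuc a = osuc b \<Longrightarrow> a = b"
  by (metis leD linorder_neqE osuc_le)

lemma osuc_less_omega1:
  assumes "a < \<omega>\<^sub>1" shows "osuc a < \<omega>\<^sub>1"
proof (rule ccontr)
  assume "\<not> osuc a < \<omega>\<^sub>1"
  then have "osuc a = \<omega>\<^sub>1" using top.not_eq_extremum by blast
  then have "{..<\<omega>\<^sub>1} \<subseteq> insert a {..<a}"
    using osuc_le[of a] by (metis insertCI leD lessThan_iff linorder_neqE subsetI)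
  then show False
    using countable_below[OF assms] uncountable_below_omega1
    by (meson countable_insert countable_subset)
qed

section \<open>Iterated derivations and their indices\<close>

function deriv_iter :: "('a set \<Rightarrow> 'a set) \<Rightarrow> 'a set \<Rightarrow> ord_w1 \<Rightarrow> 'a set" where
  "deriv_iter D H \<alpha> =
     (if \<alpha> = bot then H
      else if \<exists>\<alpha>'<\<alpha>. \<alpha> = osuc \<alpha>' then D (deriv_iter D H (THE \<alpha>'. \<alpha>' < \<alpha> \<and> \<alpha> = osuc \<alpha>'))
      else (\<Inter>\<alpha>'\<in>{..<\<alpha>}. deriv_iter D H \<alpha>'))"
  by auto

lemma the_pred: "\<alpha>' < \<alpha> \<Longrightarrow> \<alpha> = osuc \<alpha>' \<Longrightarrow> (THE \<alpha>'. \<alpha>' < \<alpha> \<and> \<alpha> = osuc \<alpha>') = \<alpha>'"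
  by (rule the_equality) (auto intro: osuc_inj)

termination
proof (relation "inv_image {(\<alpha>', \<alpha>). \<alpha>' < \<alpha>} (\<lambda>(D, H, \<alpha>). \<alpha>)")
  show "wf (inv_image {(\<alpha>', \<alpha>). \<alpha>' < \<alpha>} (\<lambda>(D :: 'a set \<Rightarrow> 'a set, H :: 'a set, \<alpha> :: ord_w1). \<alpha>))"
    by (intro wf_inv_image wf)
qed (auto simp: the_pred)

declare deriv_iter.simps [simp del]

lemma deriv_iter_zero: "deriv_iter D H bot = H"
  by (simp add: deriv_iter.simps)

lemma deriv_iter_osuc:
  assumes "\<alpha> < \<omega>\<^sub>1"
  shows "deriv_iter D H (osuc \<alpha>) = D (deriv_iter D H \<alpha>)"
proof -
  have "\<alpha> < osuc \<alpha>" using assms by (rule osuc_greater)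
  moreover from this have "osuc \<alpha> \<noteq> bot" by auto
  ultimately show ?thesis
    using the_pred[of \<alpha> "osuc \<alpha>"] by (subst deriv_iter.simps) auto
qed

lemma deriv_iter_limit:
  assumes "\<alpha> \<noteq> bot" "\<nexists>\<alpha>'. \<alpha>' < \<alpha> \<and> \<alpha> = osuc \<alpha>'"
  shows "deriv_iter D H \<alpha> = (\<Inter>\<alpha>'\<in>{..<\<alpha>}. deriv_iter D H \<alpha>')"
  using assms by (subst deriv_iter.simps) auto

definition deriv_index :: "('a set \<Rightarrow> 'a set) \<Rightarrow> 'a set \<Rightarrow> ord_w1" where
  "deriv_index D H =
     (if \<exists>\<alpha><\<omega>\<^sub>1. deriv_iter D H \<alpha> = {}
      then (LEAST \<alpha>. \<alpha> < \<omega>\<^sub>1 \<and> deriv_iter D H \<alpha> = {}) else \<omega>\<^sub>1)"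

definition osc_deriv :: "('a::metric_space \<Rightarrow> real) \<Rightarrow> real \<Rightarrow> 'a set \<Rightarrow> 'a set" where
  "osc_deriv f \<epsilon> A =
     {x \<in> A. \<forall>U. open U \<and> x \<in> U \<longrightarrow> (\<exists>x1\<in>U \<inter> A. \<exists>x2\<in>U \<inter> A. \<bar>f x1 - f x2\<bar> \<ge> \<epsilon>)}"

definition conv_deriv :: "(nat \<Rightarrow> 'a::metric_space \<Rightarrow> real) \<Rightarrow> real \<Rightarrow> 'a set \<Rightarrow> 'a set" where
  "conv_deriv F \<epsilon> A =
     {x \<in> A. \<forall>U m. open U \<and> x \<in> U \<longrightarrow>
        (\<exists>n1 n2. n1 > n2 \<and> n2 > m \<and> (\<exists>x'\<in>U \<inter> A. \<bar>F n1 x' - F n2 x'\<bar> \<ge> \<epsilon>))}"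

definition osc_index :: "'a::metric_space set \<Rightarrow> ('a \<Rightarrow> real) \<Rightarrow> ord_w1" where
  "osc_index H f = (SUP \<epsilon>\<in>{0<..}. deriv_index (osc_deriv f \<epsilon>) H)"

definition conv_index :: "'a::metric_space set \<Rightarrow> (nat \<Rightarrow> 'a \<Rightarrow> real) \<Rightarrow> ord_w1" where
  "conv_index H F = (SUP \<epsilon>\<in>{0<..}. deriv_index (conv_deriv F \<epsilon>) H)"

definition baire_one_on :: "'a::metric_space set \<Rightarrow> ('a \<Rightarrow> real) \<Rightarrow> bool" where
  "baire_one_on K f \<longleftrightarrow>
     (\<exists>g. (\<forall>n::nat. continuous_on K (g n)) \<and> (\<forall>x\<in>K. (\<lambda>n. g n x) \<longlonglongrightarrow> f x))"

end

theory Submission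
  imports Defs
begin

text \<open>
  The inequality \<open>\<beta>(f) \<le> \<gamma>((f\<^sub>n))\<close> holds for every sequence of continuous functions converging
  pointwise to \<open>f\<close>: where the sequence is uniformly Cauchy up to \<open>\<delta>\<close>, its limit is uniformly
  \<open>\<delta>\<close>-close to a continuous function and so oscillates by little more than \<open>2\<delta>\<close>
  (\<open>osc_deriv_subset_conv_deriv\<close>). Hence, when \<open>\<beta>(f) = \<omega>\<^sub>1\<close>, every sequence of continuous functions
  converging to \<open>f\<close> will do, and there is one because \<open>f\<close> is Baire-1.

  When \<open>\<beta>(f) < \<omega>\<^sub>1\<close>, put \<open>\<epsilon>\<^sub>k = 1/(k+1)\<close>. All the sets \<open>K\<^sup>\<alpha>(f,\<epsilon>\<^sub>k)\<close> eventually become empty, so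
  every \<open>x \<in> K\<close> has, for each \<open>k\<close>, a rank: the ordinal \<open>\<alpha>\<close> at which \<open>x\<close> lies in \<open>K\<^sup>\<alpha>(f,\<epsilon>\<^sub>k)\<close> but
  not in \<open>K\<^sup>\<alpha>\<^sup>+\<^sup>1(f,\<epsilon>\<^sub>k)\<close>. By definition \<open>x\<close> then has a neighbourhood \<open>U\<^sub>k(x)\<close> on which no point has
  larger \<open>k\<close>-rank, and such that the points of \<open>U\<^sub>k(x)\<close> of the same \<open>k\<close>-rank have \<open>f\<close>-values within
  \<open>\<epsilon>\<^sub>k\<close> of each other. Let \<open>V\<^sub>n(x)\<close> be the intersection of \<open>U\<^sub>0(x), \<dots>, U\<^sub>n(x)\<close> and the ball of
  radius \<open>1/(n+1)\<close>, and let \<open>f\<^sub>n\<close> average, by a finite partition of unity subordinate to the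
  cover \<open>(V\<^sub>n(x))\<close>, the values of \<open>f\<close> at the centres \<open>x\<close>.

  These functions serve all the \<open>\<epsilon>\<^sub>k\<close> at once (\<open>exists_sequence_adapted_to_ranks\<close>). Let \<open>x\<close> have \<open>k\<close>-rank \<open>\<alpha>\<close>, and let \<open>y\<close> be a point of
  the same \<open>k\<close>-rank near \<open>x\<close>. For large \<open>n\<close> a centre \<open>z\<close> contributing to \<open>f\<^sub>n(y)\<close> is close to
  \<open>x\<close>, so its \<open>k\<close>-rank is at most \<open>\<alpha>\<close>; and \<open>y \<in> U\<^sub>k(z)\<close>, so its \<open>k\<close>-rank is at least \<open>\<alpha>\<close>.
  Hence the \<open>k\<close>-ranks of \<open>y\<close> and \<open>z\<close> agree and \<open>f(z)\<close> is within \<open>\<epsilon>\<^sub>k\<close> of \<open>f(y)\<close>; therefore so is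
  \<open>f\<^sub>n(y)\<close>. This gives pointwise convergence, and it shows that one step of the convergence
  derivation with parameter \<open>2\<epsilon>\<^sub>k\<close> takes \<open>K\<^sup>\<alpha>(f,\<epsilon>\<^sub>k)\<close> into \<open>K\<^sup>\<alpha>\<^sup>+\<^sup>1(f,\<epsilon>\<^sub>k)\<close>, whence
  \<open>\<gamma>((f\<^sub>n),2\<epsilon>\<^sub>k) \<le> \<beta>(f,\<epsilon>\<^sub>k)\<close>.
\<close>

lemma deriv_iter_antimono:
  assumes "\<And>A. D A \<subseteq> A" "\<alpha> \<le> \<alpha>'" "\<alpha>' < \<omega>\<^sub>1"
  shows "deriv_iter D H \<alpha>' \<subseteq> deriv_iter D H \<alpha>"
  using assms(2,3)
proof (induction \<alpha>' rule: less_induct)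
  case (less \<alpha>')
  show ?case
  proof (cases "\<alpha> = \<alpha>'")
    case False
    then have "\<alpha> < \<alpha>'" using less.prems by simp
    show ?thesis
    proof (cases "\<exists>\<delta>. \<delta> < \<alpha>' \<and> \<alpha>' = osuc \<delta>")
      case True
      then obtain \<delta> where \<delta>: "\<delta> < \<alpha>'" "\<alpha>' = osuc \<delta>" by blast
      then have "\<alpha> \<le> \<delta>" using \<open>\<alpha> < \<alpha>'\<close> osuc_le[of \<delta> \<alpha>] by (meson leD not_le_imp_less)
      have "\<delta> < \<omega>\<^sub>1" using \<delta> less.prems by simp
      then show ?thesis
        using less.IH[OF \<delta>(1) \<open>\<alpha> \<le> \<delta>\<close>] assms(1) by (auto simp: \<delta>(2) deriv_iter_osuc)
    next
      case False
      then have "deriv_iter D H \<alpha>' = (\<Inter>\<delta>\<in>{..<\<alpha>'}. deriv_iter D H \<delta>)"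
        using \<open>\<alpha> < \<alpha>'\<close> by (intro deriv_iter_limit) auto
      then show ?thesis using \<open>\<alpha> < \<alpha>'\<close> by auto
    qed
  qed simp
qed

text \<open>
  Only the sets \<open>deriv_iter D' H \<alpha>\<close> need to be compared one step at a time: monotonicity of \<open>D\<close>
  carries the inclusion on to its own, smaller, iterates.
\<close>

lemma deriv_iter_comparison:
  assumes "mono D"
    and step: "\<And>\<alpha>. \<alpha> < \<omega>\<^sub>1 \<Longrightarrow> D (deriv_iter D' H \<alpha>) \<subseteq> D' (deriv_iter D' H \<alpha>)"
    and "\<alpha> < \<omega>\<^sub>1"
  shows "deriv_iter D H \<alpha> \<subseteq> deriv_iter D' H \<alpha>"
  using assms(3)
proof (induction \<alpha> rule: less_induct)
  case (less \<alpha>)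
  consider "\<alpha> = bot" | \<delta> where "\<delta> < \<alpha>" "\<alpha> = osuc \<delta>"
    | "\<alpha> \<noteq> bot" "\<nexists>\<delta>. \<delta> < \<alpha> \<and> \<alpha> = osuc \<delta>" by blast
  then show ?case
  proof cases
    case 1
    then show ?thesis by (simp add: deriv_iter_zero)
  next
    case 2
    then have \<delta>: "\<delta> < \<omega>\<^sub>1" using less.prems by simp
    have "D (deriv_iter D H \<delta>) \<subseteq> D (deriv_iter D' H \<delta>)"
      using \<open>mono D\<close> less.IH[OF 2(1) \<delta>] by (rule monoD)
    then show ?thesis
      using step[OF \<delta>] \<delta> by (auto simp: 2(2) deriv_iter_osuc)
  next
    case 3
    have "deriv_iter D H \<delta> \<subseteq> deriv_iter D' H \<delta>" if "\<delta> < \<alpha>" for \<delta>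
      using less.IH[OF that] less.prems that by simp
    then show ?thesis
      by (auto simp: deriv_iter_limit[OF 3])
  qed
qed

lemma deriv_index_comparison:
  assumes "mono D"
    and "\<And>\<alpha>. \<alpha> < \<omega>\<^sub>1 \<Longrightarrow> D (deriv_iter D' H \<alpha>) \<subseteq> D' (deriv_iter D' H \<alpha>)"
  shows "deriv_index D H \<le> deriv_index D' H"
proof (cases "\<exists>\<alpha><\<omega>\<^sub>1. deriv_iter D' H \<alpha> = {}")
  case True
  define \<alpha> where "\<alpha> = (LEAST \<alpha>. \<alpha> < \<omega>\<^sub>1 \<and> deriv_iter D' H \<alpha> = {})"
  have \<alpha>: "\<alpha> < \<omega>\<^sub>1" "deriv_iter D' H \<alpha> = {}"
    using LeastI_ex[OF True] by (auto simp: \<alpha>_def)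
  then have "deriv_iter D H \<alpha> = {}"
    using deriv_iter_comparison[of D D' H \<alpha>] assms by blast
  then have "deriv_index D H \<le> \<alpha>"
    using \<alpha> by (auto simp: deriv_index_def intro: Least_le)
  then show ?thesis using True by (simp add: deriv_index_def \<alpha>_def)
next
  case False
  then have "deriv_index D' H = \<omega>\<^sub>1" by (auto simp: deriv_index_def)
  then show ?thesis by simp
qed

text \<open>
  The first stage that misses \<open>x\<close> is neither \<open>0\<close> nor a limit, because limit stages are
  intersections.
\<close>

lemma deriv_rank_exists:
  assumes "x \<in> H" "deriv_index D H < \<omega>\<^sub>1"
  shows "\<exists>\<alpha><\<omega>\<^sub>1. x \<in> deriv_iter D H \<alpha> \<and> x \<notin> D (deriv_iter D H \<alpha>)"
proof -
  have ex: "\<exists>\<delta>. \<delta> < \<omega>\<^sub>1 \<and> x \<notin> deriv_iter D H \<delta>"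
    using assms(2) by (auto simp: deriv_index_def split: if_splits)
  define \<delta> where "\<delta> = (LEAST \<delta>. \<delta> < \<omega>\<^sub>1 \<and> x \<notin> deriv_iter D H \<delta>)"
  have \<delta>: "\<delta> < \<omega>\<^sub>1" "x \<notin> deriv_iter D H \<delta>"
    using LeastI_ex[OF ex] by (auto simp: \<delta>_def)
  have before: "x \<in> deriv_iter D H \<alpha>" if "\<alpha> < \<delta>" for \<alpha>
    using not_less_Least[of \<alpha>] that \<delta>(1) by (fastforce simp: \<delta>_def)
  have "\<delta> \<noteq> bot" using \<delta>(2) assms(1) by (auto simp: deriv_iter_zero)
  then obtain \<alpha> where \<alpha>: "\<alpha> < \<delta>" "\<delta> = osuc \<alpha>"
    using deriv_iter_limit[of \<delta> D H] \<delta>(2) before by auto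
  have "\<alpha> < \<omega>\<^sub>1" using \<alpha> \<delta>(1) by simp
  then show ?thesis using before[OF \<alpha>(1)] \<delta>(2) by (auto simp: \<alpha>(2) deriv_iter_osuc)
qed

lemma osc_deriv_subset: "osc_deriv f \<epsilon> A \<subseteq> A"
  by (auto simp: osc_deriv_def)

lemma mono_osc_deriv: "mono (osc_deriv f \<epsilon>)"
  unfolding mono_def osc_deriv_def by blast

lemma mono_conv_deriv: "mono (conv_deriv F \<epsilon>)"
  unfolding mono_def conv_deriv_def by blast

lemma conv_deriv_antimono_eps: "\<epsilon> \<le> \<epsilon>' \<Longrightarrow> conv_deriv F \<epsilon>' A \<subseteq> conv_deriv F \<epsilon> A"
  unfolding conv_deriv_def by (blast intro: order_trans)

lemma conv_deriv_index_antimono: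
  "\<epsilon> \<le> \<epsilon>' \<Longrightarrow> deriv_index (conv_deriv F \<epsilon>') H \<le> deriv_index (conv_deriv F \<epsilon>) H"
  by (rule deriv_index_comparison[OF mono_conv_deriv conv_deriv_antimono_eps])

section \<open>The oscillation index is at most the convergence index\<close>

text \<open>
  With \<open>\<delta> = \<epsilon>/4\<close>, the limit of a sequence which is Cauchy up to \<open>\<delta>\<close> beyond \<open>m\<close> differs by at most
  \<open>\<delta>\<close> from one term, and that term varies by less than \<open>2\<delta>\<close> on a small neighbourhood. This
  gives a variation of \<open>f\<close> below \<open>4\<delta> = \<epsilon>\<close>.
\<close>

lemma osc_deriv_subset_conv_deriv:
  assumes cont: "\<And>n. continuous_on K (F n)" and lim: "\<And>x. x \<in> K \<Longrightarrow> (\<lambda>n. F n x) \<longlonglongrightarrow> f x"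
    and "A \<subseteq> K" "\<epsilon> > 0"
  shows "osc_deriv f \<epsilon> A \<subseteq> conv_deriv F (\<epsilon>/4) A"
proof
  fix x assume x: "x \<in> osc_deriv f \<epsilon> A"
  then have "x \<in> A" by (simp add: osc_deriv_def)
  show "x \<in> conv_deriv F (\<epsilon>/4) A"
  proof (rule ccontr)
    assume "x \<notin> conv_deriv F (\<epsilon>/4) A"
    then obtain U m where U: "open U" "x \<in> U"
      and small: "\<And>n1 n2 y. n1 > n2 \<Longrightarrow> n2 > m \<Longrightarrow> y \<in> U \<inter> A \<Longrightarrow> \<bar>F n1 y - F n2 y\<bar> < \<epsilon>/4"
      using \<open>x \<in> A\<close> by (fastforce simp: conv_deriv_def not_le)
    define n where "n = Suc m"
    have close: "\<bar>f y - F n y\<bar> \<le> \<epsilon>/4" if "y \<in> U \<inter> A" for y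
    proof (rule LIMSEQ_le_const2)
      show "(\<lambda>k. \<bar>F k y - F n y\<bar>) \<longlonglongrightarrow> \<bar>f y - F n y\<bar>"
        using lim[of y] that \<open>A \<subseteq> K\<close> by (intro tendsto_intros) auto
      show "\<exists>N. \<forall>k\<ge>N. \<bar>F k y - F n y\<bar> \<le> \<epsilon>/4"
        using small[of n _ y] that by (intro exI[of _ "Suc n"]) (auto simp: n_def less_imp_le)
    qed
    obtain d where d: "d > 0" "\<And>y. y \<in> K \<Longrightarrow> dist y x < d \<Longrightarrow> \<bar>F n y - F n x\<bar> < \<epsilon>/4"
      using cont[of n] \<open>x \<in> A\<close> assms(3,4) unfolding continuous_on_iff dist_real_def
      by (metis divide_pos_pos subsetD zero_less_numeral)
    obtain y z where yz: "y \<in> (U \<inter> ball x d) \<inter> A" "z \<in> (U \<inter> ball x d) \<inter> A" "\<bar>f y - f z\<bar> \<ge> \<epsilon>"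
    proof -
      have "open (U \<inter> ball x d)" "x \<in> U \<inter> ball x d" using U d(1) by auto
      then show thesis using x that unfolding osc_deriv_def by blast
    qed
    have "\<bar>F n y - F n x\<bar> < \<epsilon>/4" "\<bar>F n z - F n x\<bar> < \<epsilon>/4"
      using yz \<open>A \<subseteq> K\<close> d(2)[of y] d(2)[of z] by (auto simp: dist_commute)
    moreover have "\<bar>f y - F n y\<bar> \<le> \<epsilon>/4" "\<bar>f z - F n z\<bar> \<le> \<epsilon>/4"
      using yz close[of y] close[of z] by auto
    ultimately show False using yz(3) by argo
  qed
qed

lemma osc_index_le_conv_index:
  assumes "\<And>n. continuous_on K (F n)" "\<And>x. x \<in> K \<Longrightarrow> (\<lambda>n. F n x) \<longlonglongrightarrow> f x"
  shows "osc_index K f \<le> conv_index K F"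
  unfolding osc_index_def
proof (rule SUP_least)
  fix \<epsilon> :: real assume "\<epsilon> \<in> {0<..}"
  then have \<epsilon>: "\<epsilon> > 0" by simp
  have "deriv_index (osc_deriv f \<epsilon>) K \<le> deriv_index (conv_deriv F (\<epsilon>/4)) K"
  proof (rule deriv_index_comparison[OF mono_osc_deriv])
    fix \<alpha> :: ord_w1 assume "\<alpha> < \<omega>\<^sub>1"
    have "deriv_iter (conv_deriv F (\<epsilon>/4)) K \<alpha> \<subseteq> deriv_iter (conv_deriv F (\<epsilon>/4)) K bot"
      using \<open>\<alpha> < \<omega>\<^sub>1\<close> by (intro deriv_iter_antimono) (auto simp: conv_deriv_def)
    then show "osc_deriv f \<epsilon> (deriv_iter (conv_deriv F (\<epsilon>/4)) K \<alpha>)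
        \<subseteq> conv_deriv F (\<epsilon>/4) (deriv_iter (conv_deriv F (\<epsilon>/4)) K \<alpha>)"
      using \<epsilon> assms by (intro osc_deriv_subset_conv_deriv) (auto simp: deriv_iter_zero)
  qed
  also have "\<dots> \<le> conv_index K F"
    unfolding conv_index_def using \<epsilon> by (intro SUP_upper) simp
  finally show "deriv_index (osc_deriv f \<epsilon>) K \<le> conv_index K F" .
qed

section \<open>A sequence adapted to the oscillation ranks\<close>

text \<open>
  A weighted average of the values of \<open>f\<close> at those centres \<open>x\<close> whose neighbourhood \<open>V x\<close> contains
  \<open>y\<close> inherits every bound that these values share: the convex hull lies in any ball that
  contains all of them.
\<close>

lemma continuous_average_over_cover:
  fixes K :: "'a::metric_space set" and f :: "'a \<Rightarrow> real"
  assumes "compact K" and V: "\<And>x. x \<in> K \<Longrightarrow> open (V x) \<and> x \<in> V x"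
  shows "\<exists>g. continuous_on K g \<and>
    (\<forall>y\<in>K. g y \<in> convex hull (f ` {x \<in> K. y \<in> V x}))"
proof -
  obtain X where X: "X \<subseteq> K" "finite X" "K \<subseteq> (\<Union>x\<in>X. V x)"
    using compactE_image[OF \<open>compact K\<close>, of K V] V by blast
  obtain \<phi> :: "'a set \<Rightarrow> 'a \<Rightarrow> real" where
    \<phi>: "\<And>W. W \<in> V ` X \<Longrightarrow> continuous_on K (\<phi> W) \<and> (\<forall>y\<in>K. 0 \<le> \<phi> W y)"
      "\<And>y W. W \<in> V ` X \<Longrightarrow> y \<in> K \<Longrightarrow> y \<notin> W \<Longrightarrow> \<phi> W y = 0"
      "\<And>y. y \<in> K \<Longrightarrow> supp_sum (\<lambda>W. \<phi> W y) (V ` X) = 1"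
  proof (rule subordinate_partition_of_unity[of K "V ` X"])
    show "\<exists>O'. open O' \<and> x \<in> O' \<and> finite {W \<in> V ` X. W \<inter> O' \<noteq> {}}" for x
      using X(2) by (intro exI[of _ UNIV]) simp
    show "open W" if "W \<in> V ` X" for W
      using that X(1) V by blast
  qed (use X(3) in auto)
  \<comment> \<open>The partition of unity is indexed by the sets \<open>V x\<close>, so a centre is chosen for each.\<close>
  define c where "c = inv_into X V"
  have c: "c W \<in> X" "V (c W) = W" if "W \<in> V ` X" for W
    using that by (auto simp: c_def inv_into_into f_inv_into_f)
  define g where "g = (\<lambda>y. \<Sum>W\<in>V ` X. \<phi> W y * f (c W))"
  have "g y \<in> convex hull (f ` {x \<in> K. y \<in> V x})" if y: "y \<in> K" for y
  proof -
    let ?\<W> = "{W \<in> V ` X. y \<in> W}"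
    have 0: "\<phi> W y = 0" if "W \<in> V ` X - ?\<W>" for W
      using \<phi>(2)[of W y] that y by blast
    have "(\<Sum>W\<in>V ` X. \<phi> W y) = 1"
    proof -
      have "supp_sum (\<lambda>W. \<phi> W y) (V ` X) = (\<Sum>W\<in>V ` X. \<phi> W y)"
        unfolding supp_sum_def support_on_def
        by (rule sum.mono_neutral_left) (use X(2) in auto)
      then show ?thesis using \<phi>(3)[OF y] by simp
    qed
    moreover have "(\<Sum>W\<in>?\<W>. \<phi> W y) = (\<Sum>W\<in>V ` X. \<phi> W y)"
      by (rule sum.mono_neutral_left) (use X(2) 0 in auto)
    ultimately have one: "(\<Sum>W\<in>?\<W>. \<phi> W y) = 1" by simp
    have "g y = (\<Sum>W\<in>?\<W>. \<phi> W y *\<^sub>R f (c W))"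
      unfolding g_def real_scaleR_def
      by (rule sum.mono_neutral_right) (use X(2) 0 in auto)
    also have "\<dots> \<in> convex hull (f ` {x \<in> K. y \<in> V x})"
    proof (rule convex_sum[OF _ convex_convex_hull one])
      show "finite ?\<W>" using X(2) by simp
      show "0 \<le> \<phi> W y" if "W \<in> ?\<W>" for W using \<phi>(1) that y by blast
      show "f (c W) \<in> convex hull (f ` {x \<in> K. y \<in> V x})" if "W \<in> ?\<W>" for W
        using c[of W] that X(1) by (intro hull_inc) auto
    qed
    finally show ?thesis .
  qed
  moreover have "continuous_on K g"
    unfolding g_def using \<phi>(1) by (intro continuous_intros) auto
  ultimately show ?thesis by blast
qed

text \<open>
  The neighbourhood witnessing \<open>x \<notin> osc_deriv f \<epsilon> A\<close> serves all its other points as well, so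
  that it misses the whole derived set.
\<close>

lemma small_oscillation_disjoint_osc_deriv:
  assumes "open U" "\<And>y z. y \<in> U \<inter> A \<Longrightarrow> z \<in> U \<inter> A \<Longrightarrow> \<bar>f y - f z\<bar> < \<epsilon>"
  shows "U \<inter> osc_deriv f \<epsilon> A = {}"
  using assms unfolding osc_deriv_def by (force simp: not_le[symmetric])

text \<open>
  The neighbourhood \<open>U\<close> and the threshold \<open>m\<close> below cannot depend on the point \<open>y\<close>: this
  uniformity is what bounds the convergence derivation, while the special case \<open>y = x\<close> is
  pointwise convergence.
\<close>

lemma exists_sequence_adapted_to_ranks:
  fixes K :: "'a::metric_space set" and f :: "'a \<Rightarrow> real"
  assumes "compact K" and "osc_index K f < \<omega>\<^sub>1"
    and \<epsilon>: "\<And>k::nat. \<epsilon> k > 0"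
  shows "\<exists>F. (\<forall>n. continuous_on K (F n)) \<and>
    (\<forall>k. \<forall>\<alpha><\<omega>\<^sub>1. \<forall>x \<in> deriv_iter (osc_deriv f (\<epsilon> k)) K \<alpha>
        - osc_deriv f (\<epsilon> k) (deriv_iter (osc_deriv f (\<epsilon> k)) K \<alpha>).
      \<exists>U m. open U \<and> x \<in> U \<and>
        (\<forall>n\<ge>m::nat. \<forall>y \<in> U \<inter> deriv_iter (osc_deriv f (\<epsilon> k)) K \<alpha>. \<bar>F n y - f y\<bar> < \<epsilon> k))"
proof -
  define T where "T = (\<lambda>k. deriv_iter (osc_deriv f (\<epsilon> k)) K)"
  have T_anti: "T k \<alpha>' \<subseteq> T k \<alpha>" if "\<alpha> \<le> \<alpha>'" "\<alpha>' < \<omega>\<^sub>1" for k \<alpha> \<alpha>'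
    unfolding T_def using osc_deriv_subset that by (rule deriv_iter_antimono)
  have T_suc: "T k (osuc \<alpha>) = osc_deriv f (\<epsilon> k) (T k \<alpha>)" if "\<alpha> < \<omega>\<^sub>1" for k \<alpha>
    unfolding T_def using that by (rule deriv_iter_osuc)
  have T_K: "T k \<alpha> \<subseteq> K" if "\<alpha> < \<omega>\<^sub>1" for k \<alpha>
    using T_anti[of bot \<alpha> k] that by (simp add: T_def deriv_iter_zero)
  have good_nbhd: "\<exists>U. open U \<and> x \<in> U \<and> (\<forall>y\<in>U \<inter> T k \<alpha>. \<forall>z\<in>U \<inter> T k \<alpha>. \<bar>f y - f z\<bar> < \<epsilon> k)"
    if "x \<in> T k \<alpha>" "x \<notin> osc_deriv f (\<epsilon> k) (T k \<alpha>)" for x k \<alpha>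
    using that unfolding osc_deriv_def by (auto simp: not_le)
  have "\<exists>\<alpha><\<omega>\<^sub>1. x \<in> T k \<alpha> \<and> x \<notin> osc_deriv f (\<epsilon> k) (T k \<alpha>)" if "x \<in> K" for k x
  proof -
    have "deriv_index (osc_deriv f (\<epsilon> k)) K \<le> osc_index K f"
      unfolding osc_index_def using \<epsilon> by (intro SUP_upper) simp
    then show ?thesis
      using deriv_rank_exists[OF that, of "osc_deriv f (\<epsilon> k)"] assms(2) by (auto simp: T_def)
  qed
  then have "\<forall>k x. \<exists>\<alpha>. x \<in> K \<longrightarrow>
      \<alpha> < \<omega>\<^sub>1 \<and> x \<in> T k \<alpha> \<and> x \<notin> osc_deriv f (\<epsilon> k) (T k \<alpha>)"
    by blast
  then obtain rk where rk: "\<And>k x. x \<in> K \<Longrightarrow>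
      rk k x < \<omega>\<^sub>1 \<and> x \<in> T k (rk k x) \<and> x \<notin> osc_deriv f (\<epsilon> k) (T k (rk k x))"
    by metis
  then have "\<forall>k x. \<exists>U. x \<in> K \<longrightarrow> open U \<and> x \<in> U \<and>
      (\<forall>y\<in>U \<inter> T k (rk k x). \<forall>z\<in>U \<inter> T k (rk k x). \<bar>f y - f z\<bar> < \<epsilon> k)"
    using good_nbhd by meson
  then obtain N where N: "\<And>k x. x \<in> K \<Longrightarrow> open (N k x) \<and> x \<in> N k x \<and>
      (\<forall>y\<in>N k x \<inter> T k (rk k x). \<forall>z\<in>N k x \<inter> T k (rk k x). \<bar>f y - f z\<bar> < \<epsilon> k)"
    by metis
  define V where "V = (\<lambda>n::nat. \<lambda>x. ball x (1 / Suc n) \<inter> (\<Inter>k\<in>{..n}. N k x))"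
  have V: "open (V n x) \<and> x \<in> V n x" if "x \<in> K" for n x
    using N[OF that] by (auto simp: V_def)
  have "\<forall>n. \<exists>g. continuous_on K g \<and> (\<forall>y\<in>K. g y \<in> convex hull (f ` {x \<in> K. y \<in> V n x}))"
    using continuous_average_over_cover[OF \<open>compact K\<close>] V by metis
  then obtain F where F: "\<And>n. continuous_on K (F n)"
    "\<And>n y. y \<in> K \<Longrightarrow> F n y \<in> convex hull (f ` {x \<in> K. y \<in> V n x})"
    by metis
  have "\<exists>U m. open U \<and> x \<in> U \<and> (\<forall>n\<ge>m. \<forall>y\<in>U \<inter> T k \<alpha>. \<bar>F n y - f y\<bar> < \<epsilon> k)"
    if \<alpha>: "\<alpha> < \<omega>\<^sub>1" and x: "x \<in> T k \<alpha>" "x \<notin> osc_deriv f (\<epsilon> k) (T k \<alpha>)" for k \<alpha> x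
  proof -
    obtain U where U: "open U" "x \<in> U"
      "\<And>y z. y \<in> U \<inter> T k \<alpha> \<Longrightarrow> z \<in> U \<inter> T k \<alpha> \<Longrightarrow> \<bar>f y - f z\<bar> < \<epsilon> k"
      using good_nbhd[OF x] by blast
    have disj: "U \<inter> T k (osuc \<alpha>) = {}"
      using small_oscillation_disjoint_osc_deriv[OF U(1,3)] T_suc[OF \<alpha>] by simp
    obtain \<rho> where \<rho>: "\<rho> > 0" "ball x \<rho> \<subseteq> U" using U(1,2) openE by blast
    obtain m0 :: nat where m0: "1 / Suc m0 < \<rho> / 2"
      using nat_approx_posE[of "\<rho>/2"] \<rho>(1) by (auto simp: field_simps)
    \<comment> \<open>Beyond \<open>k\<close> the neighbourhoods \<open>N k z\<close> take part in the cover; beyond \<open>m0\<close> the centres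
      averaged at a point of \<open>ball x (\<rho>/2)\<close> lie in \<open>ball x \<rho>\<close>.\<close>
    define m where "m = max k m0"
    have "\<bar>F n y - f y\<bar> < \<epsilon> k" if n: "n \<ge> m" and y: "y \<in> ball x (\<rho>/2) \<inter> T k \<alpha>" for n y
    proof -
      have "y \<in> K" using y T_K[OF \<alpha>] by blast
      have "f z \<in> ball (f y) (\<epsilon> k)" if z: "z \<in> K" "y \<in> V n z" for z
      proof -
        have yN: "y \<in> N k z" using z(2) n by (auto simp: V_def m_def)
        have "1 / real (Suc n) \<le> 1 / real (Suc m0)"
          using n by (intro divide_left_mono) (auto simp: m_def)
        then have "dist z y < \<rho>/2" using z(2) m0 by (auto simp: V_def)
        moreover have "dist x y < \<rho>/2" using y by simp
        ultimately have "dist x z < \<rho>"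
          using dist_triangle2[of x z y] by linarith
        then have zU: "z \<in> U" using \<rho>(2) by auto
        note rk_z = rk[OF z(1), of k]
        have "rk k z \<le> \<alpha>"
        proof (rule ccontr)
          assume "\<not> rk k z \<le> \<alpha>"
          then have "T k (rk k z) \<subseteq> T k (osuc \<alpha>)"
            using rk_z by (intro T_anti) (auto intro: osuc_le)
          then show False using rk_z zU disj by blast
        qed
        moreover have "\<alpha> \<le> rk k z"
        proof (rule ccontr)
          assume "\<not> \<alpha> \<le> rk k z"
          then have "T k \<alpha> \<subseteq> T k (osuc (rk k z))"
            using \<alpha> by (intro T_anti) (auto intro: osuc_le)
          then have "y \<in> osc_deriv f (\<epsilon> k) (T k (rk k z))"
            using y T_suc rk_z by blast
          then show False
            using yN small_oscillation_disjoint_osc_deriv[of "N k z" "T k (rk k z)" f "\<epsilon> k"]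
              N[OF z(1), of k] by blast
        qed
        ultimately have "rk k z = \<alpha>" by simp
        then show ?thesis
          using N[OF z(1), of k] rk_z yN y by (auto simp: dist_real_def)
      qed
      then have "convex hull (f ` {z \<in> K. y \<in> V n z}) \<subseteq> ball (f y) (\<epsilon> k)"
        by (intro hull_minimal) auto
      then show ?thesis
        using F(2)[OF \<open>y \<in> K\<close>, of n] by (auto simp: dist_real_def)
    qed
    moreover have "open (ball x (\<rho>/2))" "x \<in> ball x (\<rho>/2)" using \<rho>(1) by auto
    ultimately show ?thesis by blast
  qed
  then show ?thesis using F(1) unfolding T_def by (intro exI[of _ F]) blast
qed

theorem theorem5p5:
  fixes K :: "'a::metric_space set" and f :: "'a \<Rightarrow> real"
  assumes "compact K" and "baire_one_on K f"
  shows "\<exists>F :: nat \<Rightarrow> 'a \<Rightarrow> real.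
    (\<forall>n. continuous_on K (F n)) \<and> (\<forall>x\<in>K. (\<lambda>n. F n x) \<longlonglongrightarrow> f x) \<and>
    conv_index K F = osc_index K f"
proof (cases "osc_index K f < \<omega>\<^sub>1")
  case False
  then have top: "osc_index K f = \<omega>\<^sub>1" using top.not_eq_extremum by blast
  obtain F where F: "\<And>n. continuous_on K (F n)" "\<And>x. x \<in> K \<Longrightarrow> (\<lambda>n. F n x) \<longlonglongrightarrow> f x"
    using assms(2) unfolding baire_one_on_def by blast
  have "conv_index K F = osc_index K f"
    using osc_index_le_conv_index[OF F] by (simp add: top top.extremum_unique)
  then show ?thesis using F by blast
next
  case True
  define \<epsilon> where "\<epsilon> = (\<lambda>k::nat. 1 / real (Suc k))"
  have \<epsilon>: "\<epsilon> k > 0" for k by (simp add: \<epsilon>_def)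
  define T where "T = (\<lambda>k. deriv_iter (osc_deriv f (\<epsilon> k)) K)"
  have "\<exists>F :: nat \<Rightarrow> 'a \<Rightarrow> real. (\<forall>n. continuous_on K (F n)) \<and>
    (\<forall>k. \<forall>\<alpha><\<omega>\<^sub>1. \<forall>x \<in> T k \<alpha> - osc_deriv f (\<epsilon> k) (T k \<alpha>).
      \<exists>U m. open U \<and> x \<in> U \<and> (\<forall>n\<ge>m. \<forall>y\<in>U \<inter> T k \<alpha>. \<bar>F n y - f y\<bar> < \<epsilon> k))"
    unfolding T_def using assms(1) True \<epsilon> by (rule exists_sequence_adapted_to_ranks)
  then obtain F :: "nat \<Rightarrow> 'a \<Rightarrow> real" where F: "\<And>n. continuous_on K (F n)"
    and near_all: "\<forall>k. \<forall>\<alpha><\<omega>\<^sub>1. \<forall>x \<in> T k \<alpha> - osc_deriv f (\<epsilon> k) (T k \<alpha>).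
      \<exists>U m. open U \<and> x \<in> U \<and> (\<forall>n\<ge>m. \<forall>y\<in>U \<inter> T k \<alpha>. \<bar>F n y - f y\<bar> < \<epsilon> k)"
    by blast
  have near: "\<exists>U m. open U \<and> x \<in> U \<and> (\<forall>n\<ge>m. \<forall>y\<in>U \<inter> T k \<alpha>. \<bar>F n y - f y\<bar> < \<epsilon> k)"
    if "\<alpha> < \<omega>\<^sub>1" "x \<in> T k \<alpha>" "x \<notin> osc_deriv f (\<epsilon> k) (T k \<alpha>)" for k \<alpha> x
    using near_all that by (meson DiffI)
  have index_le: "deriv_index (osc_deriv f (\<epsilon> k)) K \<le> osc_index K f" for k
    unfolding osc_index_def using \<epsilon> by (intro SUP_upper) simp
  have lim: "(\<lambda>n. F n x) \<longlonglongrightarrow> f x" if xK: "x \<in> K" for x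
  proof (rule LIMSEQ_I)
    fix r :: real assume "r > 0"
    then obtain k where k: "\<epsilon> k < r" using nat_approx_posE[of r] by (auto simp: \<epsilon>_def)
    obtain \<alpha> where \<alpha>: "\<alpha> < \<omega>\<^sub>1" "x \<in> T k \<alpha>" "x \<notin> osc_deriv f (\<epsilon> k) (T k \<alpha>)"
      using deriv_rank_exists[OF xK] index_le[of k] True unfolding T_def
      by (meson le_less_trans)
    show "\<exists>m. \<forall>n\<ge>m. norm (F n x - f x) < r"
      using near[OF \<alpha>] \<alpha>(2) k by (metis IntI less_trans real_norm_def)
  qed
  have step: "conv_deriv F (2 * \<epsilon> k) (T k \<alpha>) \<subseteq> osc_deriv f (\<epsilon> k) (T k \<alpha>)"
    if \<alpha>: "\<alpha> < \<omega>\<^sub>1" for k \<alpha>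
  proof
    fix x assume x: "x \<in> conv_deriv F (2 * \<epsilon> k) (T k \<alpha>)"
    then have xT: "x \<in> T k \<alpha>" by (simp add: conv_deriv_def)
    show "x \<in> osc_deriv f (\<epsilon> k) (T k \<alpha>)"
    proof (rule ccontr)
      assume "x \<notin> osc_deriv f (\<epsilon> k) (T k \<alpha>)"
      from near[OF \<alpha> xT this] obtain U m where U: "open U" "x \<in> U"
        and small: "\<And>n y. n \<ge> m \<Longrightarrow> y \<in> U \<inter> T k \<alpha> \<Longrightarrow> \<bar>F n y - f y\<bar> < \<epsilon> k"
        by blast
      obtain n1 n2 y where "n1 > n2" "n2 > m" "y \<in> U \<inter> T k \<alpha>" "\<bar>F n1 y - F n2 y\<bar> \<ge> 2 * \<epsilon> k"
        using x U unfolding conv_deriv_def by blast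
      then show False using small[of n1 y] small[of n2 y] by force
    qed
  qed
  have "conv_index K F \<le> osc_index K f"
    unfolding conv_index_def
  proof (rule SUP_least)
    fix r :: real assume "r \<in> {0<..}"
    then obtain k where "\<epsilon> k < r/2" using nat_approx_posE[of "r/2"] by (auto simp: \<epsilon>_def)
    then have "deriv_index (conv_deriv F r) K \<le> deriv_index (conv_deriv F (2 * \<epsilon> k)) K"
      by (intro conv_deriv_index_antimono) simp
    also have "\<dots> \<le> deriv_index (osc_deriv f (\<epsilon> k)) K"
      using step[of _ k] unfolding T_def by (rule deriv_index_comparison[OF mono_conv_deriv])
    also note index_le
    finally show "deriv_index (conv_deriv F r) K \<le> osc_index K f" .
  qed
  then have "conv_index K F = osc_index K f"
    using osc_index_le_conv_index[OF F lim] by simp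
  then show ?thesis using F lim by blast
qed

end
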